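(* Let $g$ be a derivator, $n\in\mathbb N$ and $p\in\operatorname{P}_n(\mathbb R)$. Then $p$ changes sign at most $n$ times on $\mathbb R_+$; that is, there do not exist points $t_1<_g t_2<_g\cdots<_g t_{n+2}$ in $\mathbb R_+$ such that $p(t_i)p(t_{i+1})<0$ for all $i\in\{1,\dots,n+1\}$.
   Context: $\mathbb N=\{0,1,2,\dots\}$. A derivator is a left-continuous nondecreasing function $g:\mathbb R\to\mathbb R$; $\mu_g$ is the Lebesgue–Stieltjes measure with $\mu_g([a,b))=g(b)-g(a)$. Write $g(t^+)$ for the right-hand limit and $D_g=\{t\in\mathbb R:g(t^+)>g(t)\}$. $\mathbb R_+$ is the disjoint union of $\mathbb R$ and a formal copy $\{t^+:t\in D_g\}$ of $D_g$; $g$ is extended to $\mathbb R_+$ by letting $g(t^+)$ be the right-hand limit of $g$ at $t$. For $x,y\in\mathbb R_+$, $x<_g y$ means $g(x)<g(y)$. Put $\int_x^y f\,d\mu_g=\int_{[x,y)}f\,d\mu_g$ if $y\ge x$ and $-\int_{[y,x)}f\,d\mu_g$ if $y<x$. For $x_0\in\mathbb R$ the $g$-monomials are $g_{x_0,0}(x)=1$ and $g_{x_0,n}(x)=n\int_{x_0}^x g_{x_0,n-1}\,d\mu_g$ for $n\ge1$, $x\in\mathbb R$. $\operatorname{P}_n(\mathbb R)$ is the real vector space of functions spanned by $g_{x_0,0},\dots,g_{x_0,n}$ (it does not depend on $x_0$). Its elements are evaluated at $t^+$ ($t\in D_g$) by the right-hand limit at $t$. *)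

theory Defs
  imports "HOL-Analysis.Analysis"
begin

definition derivator :: "(real \<Rightarrow> real) \<Rightarrow> bool" where
  "derivator g \<longleftrightarrow> mono g \<and> (\<forall>t. continuous (at_left t) g)"

definition right_lim :: "(real \<Rightarrow> real) \<Rightarrow> real \<Rightarrow> real" where
  "right_lim f t = Lim (at_right t) f"

definition jump_set :: "(real \<Rightarrow> real) \<Rightarrow> real set" where
  "jump_set g = {t. right_lim g t > g t}"

text \<open>
  The library's \<^const>\<open>interval_measure\<close> is built from right-continuous functions and half-open
  intervals that are closed on the right. For a left-continuous \<open>g\<close> it is applied to the
  reflection \<open>x \<mapsto> - g (- x)\<close> and the result is pushed forward along \<open>x \<mapsto> - x\<close>. The lemma
  \<open>emeasure_stieltjes_measure\<close> below states the defining property of \<open>\<mu>\<^sub>g\<close>.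
\<close>

definition stieltjes_measure :: "(real \<Rightarrow> real) \<Rightarrow> real measure" where
  "stieltjes_measure g = distr (interval_measure (\<lambda>x. - g (- x))) borel uminus"

lemma sets_stieltjes_measure [simp]: "sets (stieltjes_measure g) = sets borel"
  by (simp add: stieltjes_measure_def)

lemma emeasure_stieltjes_measure:
  assumes g: "derivator g" and ab: "a \<le> b"
  shows "emeasure (stieltjes_measure g) {a..<b} = ennreal (g b - g a)"
proof -
  let ?F = "\<lambda>x. - g (- x)"
  have "uminus -` {a..<b} = {-b<..-a}"
    by auto
  then have "emeasure (stieltjes_measure g) {a..<b} = emeasure (interval_measure ?F) {-b<..-a}"
    by (simp add: stieltjes_measure_def emeasure_distr)
  also have "\<dots> = ennreal (?F (-a) - ?F (-b))"
  proof (rule emeasure_interval_measure_Ioc)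
    show "-b \<le> -a" using ab by simp
    show "?F x \<le> ?F y" if "x \<le> y" for x y
      using g that monoD[of g "- y" "- x"] by (simp add: derivator_def)
    show "continuous (at_right x) ?F" for x
    proof -
      have "(g \<longlongrightarrow> g (- x)) (at_left (- x))"
        using g by (simp add: derivator_def continuous_within)
      then have "((\<lambda>y. g (- y)) \<longlongrightarrow> g (- x)) (at_right x)"
        by (simp add: at_left_minus filterlim_filtermap)
      then show ?thesis
        by (auto simp: continuous_within intro: tendsto_minus)
    qed
  qed
  finally show ?thesis by simp
qed

text \<open>
  Points of \<open>\<real>\<^sub>+\<close>: \<open>Pt t\<close> is the real number \<open>t\<close>, and \<open>RPlus t\<close> is the formal point \<open>t\<^sup>+\<close>, which
  belongs to the carrier \<open>ext_line g\<close> only for \<open>t\<close> in the jump set of \<open>g\<close>.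
\<close>

datatype ext_pt = Pt real | RPlus real

definition ext_line :: "(real \<Rightarrow> real) \<Rightarrow> ext_pt set" where
  "ext_line g = range Pt \<union> RPlus ` jump_set g"

fun ext_eval :: "(real \<Rightarrow> real) \<Rightarrow> ext_pt \<Rightarrow> real" where
  "ext_eval f (Pt t) = f t"
| "ext_eval f (RPlus t) = right_lim f t"

definition g_less :: "(real \<Rightarrow> real) \<Rightarrow> ext_pt \<Rightarrow> ext_pt \<Rightarrow> bool" where
  "g_less g x y \<longleftrightarrow> ext_eval g x < ext_eval g y"

definition g_integral :: "(real \<Rightarrow> real) \<Rightarrow> real \<Rightarrow> real \<Rightarrow> (real \<Rightarrow> real) \<Rightarrow> real" where
  "g_integral g x y f =
     (if x \<le> y then (LINT s:{x..<y}|stieltjes_measure g. f s)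
      else - (LINT s:{y..<x}|stieltjes_measure g. f s))"

primrec g_monomial :: "(real \<Rightarrow> real) \<Rightarrow> real \<Rightarrow> nat \<Rightarrow> real \<Rightarrow> real" where
  "g_monomial g x0 0 = (\<lambda>x. 1)"
| "g_monomial g x0 (Suc n) = (\<lambda>x. real (Suc n) * g_integral g x0 x (g_monomial g x0 n))"

text \<open>
  The span of the \<open>g\<close>-monomials of order at most \<open>n\<close>. It does not depend on the centre \<open>x0\<close>, which
  is kept as a parameter.
\<close>

definition g_polys :: "(real \<Rightarrow> real) \<Rightarrow> real \<Rightarrow> nat \<Rightarrow> (real \<Rightarrow> real) set" where
  "g_polys g x0 n = {p. \<exists>c :: nat \<Rightarrow> real. p = (\<lambda>x. \<Sum>k\<le>n. c k * g_monomial g x0 k x)}"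

end

theory Submission
  imports Defs
begin

text \<open>
  If \<open>p\<close> alternates in sign along \<open>t\<^sub>1 < \<dots> < t\<^sub>n\<^sub>+\<^sub>2\<close>, then \<open>p t\<^sub>i\<^sub>+\<^sub>1 - p t\<^sub>i\<close> is the integral over
  \<open>[t\<^sub>i, t\<^sub>i\<^sub>+\<^sub>1)\<close> of a \<open>g\<close>-polynomial \<open>q\<close> of lower order and has the sign of \<open>p t\<^sub>i\<^sub>+\<^sub>1\<close>. So \<open>q\<close> has
  that sign at some \<open>s\<^sub>i\<close> in the interval, and alternates along the \<open>n + 1\<close> points \<open>s\<^sub>i\<close>. Induction on \<open>n\<close>
  excludes this for real points. A point \<open>t\<^sup>+\<close> is reduced to the real point \<open>t + \<epsilon>\<close>, because
  \<open>g\<close>-polynomials are locally Lipschitz with respect to \<open>g\<close> and hence have right-hand limits.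
\<close>

section \<open>Functions that are locally Lipschitz with respect to \<open>g\<close>\<close>

definition locally_g_lipschitz :: "(real \<Rightarrow> real) \<Rightarrow> (real \<Rightarrow> real) \<Rightarrow> bool" where
  "locally_g_lipschitz g f \<longleftrightarrow>
     (\<forall>a b. \<exists>C. \<forall>x y. a \<le> x \<longrightarrow> x \<le> y \<longrightarrow> y \<le> b \<longrightarrow> \<bar>f y - f x\<bar> \<le> C * (g y - g x))"

lemma locally_g_lipschitzE:
  assumes "locally_g_lipschitz g f"
  obtains C where "\<And>x y. a \<le> x \<Longrightarrow> x \<le> y \<Longrightarrow> y \<le> b \<Longrightarrow> \<bar>f y - f x\<bar> \<le> C * (g y - g x)"
  using assms unfolding locally_g_lipschitz_def by meson

lemma locally_g_lipschitz_const: "locally_g_lipschitz g (\<lambda>x. c)"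
  unfolding locally_g_lipschitz_def by (intro allI exI[of _ 0]) auto

lemma locally_g_lipschitz_add:
  assumes "locally_g_lipschitz g f" "locally_g_lipschitz g h"
  shows "locally_g_lipschitz g (\<lambda>x. f x + h x)"
  unfolding locally_g_lipschitz_def
proof (intro allI)
  fix a b
  obtain C where C: "\<And>x y. a \<le> x \<Longrightarrow> x \<le> y \<Longrightarrow> y \<le> b \<Longrightarrow> \<bar>f y - f x\<bar> \<le> C * (g y - g x)"
    using locally_g_lipschitzE[OF assms(1)] by metis
  obtain D where D: "\<And>x y. a \<le> x \<Longrightarrow> x \<le> y \<Longrightarrow> y \<le> b \<Longrightarrow> \<bar>h y - h x\<bar> \<le> D * (g y - g x)"
    using locally_g_lipschitzE[OF assms(2)] by metis
  have "\<bar>(f y + h y) - (f x + h x)\<bar> \<le> (C + D) * (g y - g x)" if "a \<le> x" "x \<le> y" "y \<le> b" for x y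
    using C[OF that] D[OF that] by (simp add: distrib_right)
  then show "\<exists>C. \<forall>x y. a \<le> x \<longrightarrow> x \<le> y \<longrightarrow> y \<le> b \<longrightarrow>
      \<bar>(f y + h y) - (f x + h x)\<bar> \<le> C * (g y - g x)"
    by blast
qed

lemma locally_g_lipschitz_cmult:
  assumes "locally_g_lipschitz g f"
  shows "locally_g_lipschitz g (\<lambda>x. c * f x)"
  unfolding locally_g_lipschitz_def
proof (intro allI)
  fix a b
  obtain C where C: "\<And>x y. a \<le> x \<Longrightarrow> x \<le> y \<Longrightarrow> y \<le> b \<Longrightarrow> \<bar>f y - f x\<bar> \<le> C * (g y - g x)"
    using locally_g_lipschitzE[OF assms] by metis
  have "\<bar>c * f y - c * f x\<bar> \<le> (\<bar>c\<bar> * C) * (g y - g x)" if "a \<le> x" "x \<le> y" "y \<le> b" for x y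
    using mult_left_mono[OF C[OF that], of "\<bar>c\<bar>"]
    by (simp add: abs_mult[symmetric] right_diff_distrib[symmetric] mult.assoc)
  then show "\<exists>C. \<forall>x y. a \<le> x \<longrightarrow> x \<le> y \<longrightarrow> y \<le> b \<longrightarrow> \<bar>c * f y - c * f x\<bar> \<le> C * (g y - g x)"
    by blast
qed

lemma locally_g_lipschitz_sum:
  assumes "\<And>k. k \<in> A \<Longrightarrow> locally_g_lipschitz g (f k)"
  shows "locally_g_lipschitz g (\<lambda>x. \<Sum>k\<in>A. f k x)"
  using assms
  by (induction A rule: infinite_finite_induct)
     (simp_all add: locally_g_lipschitz_const locally_g_lipschitz_add)

text \<open>The term \<open>C * g\<close> absorbs every decrease of \<open>f\<close>, so
  \<open>f\<close> is a monotone function minus a multiple of \<open>g\<close>. Right-hand limits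
  and Borel measurability thus reduce to the monotone case.\<close>

lemma mono_on_add_derivator:
  fixes f g :: "real \<Rightarrow> real"
  assumes "\<And>x y. a \<le> x \<Longrightarrow> x \<le> y \<Longrightarrow> y \<le> b \<Longrightarrow> \<bar>f y - f x\<bar> \<le> C * (g y - g x)"
  shows "mono_on {a..b} (\<lambda>x. f x + C * g x)"
proof (rule mono_onI)
  fix r s assume "r \<in> {a..b}" "s \<in> {a..b}" "r \<le> s"
  then show "f r + C * g r \<le> f s + C * g s"
    using assms[of r s] by (simp add: right_diff_distrib abs_le_iff)
qed

lemma mono_on_right_limit:
  fixes f :: "real \<Rightarrow> real"
  assumes "mono_on {t..b} f" "t < b"
  shows "\<exists>l. (f \<longlongrightarrow> l) (at_right t)"
proof -
  \<comment> \<open>The limit is the infimum of the values to the right, which \<open>f t\<close>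
    bounds from below.\<close>
  have "(f \<longlongrightarrow> Inf (f ` ({t<..} \<inter> {..b}))) (at t within ({t<..} \<inter> {..b}))"
    by (rule Lim_right_bound[where K = "f t"])
       (use assms in \<open>auto intro: mono_onD[OF assms(1)]\<close>)
  moreover have "at t within ({t<..} \<inter> {..b}) = at_right t"
    by (rule at_within_nhd[where S = "{..<b}"]) (use assms in auto)
  ultimately show ?thesis by auto
qed

text \<open>\<open>right_lim\<close> is defined by \<open>Lim\<close>, which says something about
  \<open>f\<close> only once a limit is known to exist.\<close>

lemma locally_g_lipschitz_right_lim:
  assumes g: "derivator g" and f: "locally_g_lipschitz g f"
  shows "(f \<longlongrightarrow> right_lim f t) (at_right t)"
proof -
  obtain C where C: "\<And>x y. t \<le> x \<Longrightarrow> x \<le> y \<Longrightarrow> y \<le> t + 1 \<Longrightarrow> \<bar>f y - f x\<bar> \<le> C * (g y - g x)"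
    using locally_g_lipschitzE[OF f] by metis
  obtain l where l: "((\<lambda>x. f x + C * g x) \<longlongrightarrow> l) (at_right t)"
    using mono_on_right_limit[of t "t + 1"] mono_on_add_derivator[of t "t + 1", OF C] by force
  have "mono_on {t..t+1} g"
    using g by (auto simp: derivator_def mono_on_def mono_def)
  then obtain m where m: "(g \<longlongrightarrow> m) (at_right t)"
    using mono_on_right_limit[of t "t + 1" g] by auto
  have "((\<lambda>x. (f x + C * g x) - C * g x) \<longlongrightarrow> l - C * m) (at_right t)"
    by (intro tendsto_intros l m)
  then have lim: "(f \<longlongrightarrow> l - C * m) (at_right t)"
    by simp
  then have "right_lim f t = l - C * m"
    unfolding right_lim_def by (intro tendsto_Lim) simp_all
  with lim show ?thesis by simp
qed

lemma locally_g_lipschitz_bounded: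
  assumes g: "derivator g" and f: "locally_g_lipschitz g f"
  obtains B where "\<And>x. a \<le> x \<Longrightarrow> x \<le> b \<Longrightarrow> \<bar>f x\<bar> \<le> B"
proof -
  obtain C where C: "\<And>x y. a \<le> x \<Longrightarrow> x \<le> y \<Longrightarrow> y \<le> b \<Longrightarrow> \<bar>f y - f x\<bar> \<le> C * (g y - g x)"
    using locally_g_lipschitzE[OF f] by metis
  have "\<bar>f x\<bar> \<le> \<bar>f a\<bar> + \<bar>C\<bar> * (g b - g a)" if "a \<le> x" "x \<le> b" for x
  proof -
    have "g a \<le> g x" "g x \<le> g b"
      using g that by (auto simp: derivator_def mono_def)
    \<comment> \<open>The sign of \<open>C\<close> is unknown, hence the absolute value.\<close>
    then have "C * (g x - g a) \<le> \<bar>C\<bar> * (g b - g a)"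
      by (intro mult_mono) auto
    then show ?thesis
      using C[of a x] that by linarith
  qed
  then show ?thesis by (rule that)
qed

section \<open>Integration against the Stieltjes measure\<close>

lemma locally_g_lipschitz_set_integrable:
  assumes g: "derivator g" and f: "locally_g_lipschitz g f"
  shows "set_integrable (stieltjes_measure g) {a..<b} f"
proof (cases "a \<le> b")
  case True
  obtain C where C: "\<And>x y. a \<le> x \<Longrightarrow> x \<le> y \<Longrightarrow> y \<le> b \<Longrightarrow> \<bar>f y - f x\<bar> \<le> C * (g y - g x)"
    using locally_g_lipschitzE[OF f] by metis
  obtain B where B: "\<And>x. a \<le> x \<Longrightarrow> x \<le> b \<Longrightarrow> \<bar>f x\<bar> \<le> B"
    using locally_g_lipschitz_bounded[OF g f] by metis
  have "mono_on {a..<b} (\<lambda>x. f x + C * g x)"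
    by (rule mono_on_subset[OF mono_on_add_derivator[OF C]]) auto
  then have 1: "(\<lambda>x. f x + C * g x) \<in> borel_measurable (restrict_space borel {a..<b})"
    by (rule borel_measurable_mono_on_fnc)
  have "mono_on {a..<b} g"
    using g by (auto simp: derivator_def mono_on_def mono_def)
  then have 2: "g \<in> borel_measurable (restrict_space borel {a..<b})"
    by (rule borel_measurable_mono_on_fnc)
  have "(\<lambda>x. (f x + C * g x) - C * g x) \<in> borel_measurable (restrict_space borel {a..<b})"
    using 1 2 by measurable
  then have "(\<lambda>x. indicator {a..<b} x *\<^sub>R f x) \<in> borel_measurable borel"
    by (subst (asm) borel_measurable_restrict_space_iff) auto
  then have "(\<lambda>x. indicator {a..<b} x *\<^sub>R f x) \<in> borel_measurable (stieltjes_measure g)"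
    by (simp cong: measurable_cong_sets)
  \<comment> \<open>What remains is boundedness by \<open>B\<close> on a set of finite measure
    \<open>g b - g a\<close>.\<close>
  then show ?thesis
    unfolding set_integrable_def
    by (rule integrableI_bounded_set[where A = "{a..<b}" and B = B, rotated])
       (use B True in \<open>auto simp: emeasure_stieltjes_measure[OF g] indicator_def\<close>)
qed (simp add: set_integrable_def)

text \<open>The orientation convention makes \<open>g_integral\<close> additive wherever
  \<open>x0\<close> lies, so the centre drops out of differences.\<close>

lemma g_integral_diff:
  assumes g: "derivator g" and f: "locally_g_lipschitz g f" and xy: "x \<le> y"
  shows "g_integral g x0 y f - g_integral g x0 x f = (LINT s:{x..<y}|stieltjes_measure g. f s)"
proof -
  \<comment> \<open>Half-open intervals tile without overlap: an atom at \<open>b\<close> is counted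
    only in the second one.\<close>
  have split: "(LINT s:{a..<c}|stieltjes_measure g. f s) =
      (LINT s:{a..<b}|stieltjes_measure g. f s) + (LINT s:{b..<c}|stieltjes_measure g. f s)"
    if "a \<le> b" "b \<le> c" for a b c
    using set_integral_Un[OF _ locally_g_lipschitz_set_integrable[OF g f]
        locally_g_lipschitz_set_integrable[OF g f], of a b b c] that
    by (simp add: ivl_disj_un_two(3))
  consider "x0 \<le> x" | "x < x0" "x0 \<le> y" | "y < x0" by linarith
  then show ?thesis
  proof cases
    case 1
    then show ?thesis
      unfolding g_integral_def using xy split[of x0 x y] by simp
  next
    case 2
    then show ?thesis
      unfolding g_integral_def using xy split[of x x0 y] by simp
  next
    case 3
    then show ?thesis
      unfolding g_integral_def using xy split[of x y x0] by simp
  qed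
qed

text \<open>Since \<open>{x..<y}\<close> has measure \<open>g y - g x\<close>, a bound for
  \<open>f\<close> on \<open>[a, b]\<close> is a Lipschitz constant for its integral there. This
  closure property drives the induction over the monomials.\<close>

lemma locally_g_lipschitz_g_integral:
  assumes g: "derivator g" and f: "locally_g_lipschitz g f"
  shows "locally_g_lipschitz g (\<lambda>x. g_integral g x0 x f)"
  unfolding locally_g_lipschitz_def
proof (intro allI)
  fix a b
  obtain B where B: "\<And>x. a \<le> x \<Longrightarrow> x \<le> b \<Longrightarrow> \<bar>f x\<bar> \<le> B"
    using locally_g_lipschitz_bounded[OF g f] by metis
  have "\<bar>g_integral g x0 y f - g_integral g x0 x f\<bar> \<le> B * (g y - g x)"
    if xy: "a \<le> x" "x \<le> y" "y \<le> b" for x y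
  proof -
    let ?M = "stieltjes_measure g"
    have "g x \<le> g y"
      using g xy by (auto simp: derivator_def mono_def)
    then have m: "measure ?M {x..<y} = g y - g x"
      by (simp add: measure_def emeasure_stieltjes_measure[OF g xy(2)])
    have "norm (LINT s:{x..<y}|?M. f s) \<le> (LINT s:{x..<y}|?M. norm (f s))"
      by (rule set_integral_norm_bound[OF locally_g_lipschitz_set_integrable[OF g f]])
    also have "\<dots> \<le> (LINT s:{x..<y}|?M. B)"
    proof (rule set_integral_mono)
      show "set_integrable ?M {x..<y} (\<lambda>s. norm (f s))"
        by (rule set_integrable_norm[OF locally_g_lipschitz_set_integrable[OF g f]])
      show "set_integrable ?M {x..<y} (\<lambda>s. B)"
        by (rule locally_g_lipschitz_set_integrable[OF g locally_g_lipschitz_const])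
    qed (use B xy in auto)
    also have "\<dots> = B * (g y - g x)"
      using m by (simp add: set_lebesgue_integral_def)
    finally show ?thesis
      by (simp add: g_integral_diff[OF g f xy(2)])
  qed
  then show "\<exists>C. \<forall>x y. a \<le> x \<longrightarrow> x \<le> y \<longrightarrow> y \<le> b \<longrightarrow>
      \<bar>g_integral g x0 y f - g_integral g x0 x f\<bar> \<le> C * (g y - g x)"
    by blast
qed

section \<open>Regularity and increments of \<open>g\<close>-polynomials\<close>

lemma locally_g_lipschitz_g_monomial:
  assumes "derivator g"
  shows "locally_g_lipschitz g (g_monomial g x0 k)"
  by (induction k)
     (auto intro!: locally_g_lipschitz_const locally_g_lipschitz_cmult
        locally_g_lipschitz_g_integral[OF assms] simp del: of_nat_Suc)

lemma locally_g_lipschitz_g_polys: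
  assumes "derivator g" "p \<in> g_polys g x0 n"
  shows "locally_g_lipschitz g p"
  using assms unfolding g_polys_def
  by (auto intro!: locally_g_lipschitz_sum locally_g_lipschitz_cmult locally_g_lipschitz_g_monomial)

text \<open>Here \<open>q\<close> acts as the \<open>g\<close>-derivative of \<open>p\<close>: by
  the recursion, the monomial of order \<open>Suc k\<close> contributes \<open>Suc k\<close> times
  the one of order \<open>k\<close>.\<close>

lemma g_polys_Suc_diff:
  assumes g: "derivator g" and p: "p \<in> g_polys g x0 (Suc n)"
  obtains q where "q \<in> g_polys g x0 n"
    "\<And>x y. x \<le> y \<Longrightarrow> p y - p x = (LINT s:{x..<y}|stieltjes_measure g. q s)"
proof -
  let ?M = "stieltjes_measure g"
  obtain c where c: "p = (\<lambda>x. \<Sum>k\<le>Suc n. c k * g_monomial g x0 k x)"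
    using p unfolding g_polys_def by auto
  define q where "q = (\<lambda>x. \<Sum>k\<le>n. (c (Suc k) * real (Suc k)) * g_monomial g x0 k x)"
  have "q \<in> g_polys g x0 n"
    unfolding g_polys_def q_def mem_Collect_eq
    by (rule exI[of _ "\<lambda>k. c (Suc k) * real (Suc k)"]) (rule refl)
  moreover have "p y - p x = (LINT s:{x..<y}|?M. q s)" if "x \<le> y" for x y
  proof -
    have int: "set_integrable ?M {x..<y} (g_monomial g x0 k)" for k
      by (intro locally_g_lipschitz_set_integrable g locally_g_lipschitz_g_monomial)
    have "p y - p x = (\<Sum>k\<le>n. (c (Suc k) * real (Suc k)) *
        (g_integral g x0 y (g_monomial g x0 k) - g_integral g x0 x (g_monomial g x0 k)))"
      \<comment> \<open>The term of order 0 is split off; it is constant and cancels.\<close>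
      unfolding c sum.atMost_Suc_shift
      by (simp add: sum_subtractf[symmetric] right_diff_distrib mult.assoc del: of_nat_Suc)
    also have "\<dots> = (\<Sum>k\<le>n. (c (Suc k) * real (Suc k)) * (LINT s:{x..<y}|?M. g_monomial g x0 k s))"
      using g_integral_diff[OF g locally_g_lipschitz_g_monomial[OF g] that] by simp
    also have "\<dots> = (\<Sum>k\<le>n. LINT s:{x..<y}|?M. (c (Suc k) * real (Suc k)) * g_monomial g x0 k s)"
      by simp
    also have "\<dots> = (LINT s:{x..<y}|?M. q s)"
      unfolding q_def set_lebesgue_integral_def scaleR_sum_right
      by (rule Bochner_Integration.integral_sum[symmetric])
         (use set_integrable_mult_right[OF int] in \<open>simp add: set_integrable_def\<close>)
    finally show ?thesis .
  qed
  ultimately show ?thesis by (rule that)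
qed

section \<open>Sign changes at real points\<close>

lemma set_integral_pos_imp_ex_pos:
  fixes f :: "'a \<Rightarrow> real"
  assumes "0 < w * (LINT s:A|M. f s)"
  obtains s where "s \<in> A" "0 < w * f s"
proof -
  have "\<exists>s\<in>A. 0 < w * f s"
  proof (rule ccontr)
    assume "\<not> ?thesis"
    \<comment> \<open>A nonintegrable integrand has integral 0 by default, so nonnegativity holds in
      every case.\<close>
    then have "0 \<le> (LINT s:A|M. - (w * f s))"
      unfolding set_lebesgue_integral_def
      by (intro Bochner_Integration.integral_nonneg) (auto simp: indicator_def not_less)
    also have "\<dots> = - (w * (LINT s:A|M. f s))"
      by (simp add: set_lebesgue_integral_def mult.left_commute)
    finally show False using assms by simp
  qed
  then show ?thesis using that by blast
qed

lemma g_polys_sign_changes_real: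
  assumes g: "derivator g" and "p \<in> g_polys g x0 n"
  shows "\<not> (\<forall>i\<in>{1..n + 1}. t i < t (i + 1) \<and> p (t i) * p (t (i + 1)) < 0)"
  using assms(2)
proof (induction n arbitrary: p t)
  case 0
  \<comment> \<open>Here \<open>p\<close> is constant, so the single product to be considered is a
    square.\<close>
  then show ?case by (auto simp: g_polys_def not_less)
next
  case (Suc n)
  show ?case
  proof
    assume alt: "\<forall>i\<in>{1..Suc n + 1}. t i < t (i + 1) \<and> p (t i) * p (t (i + 1)) < 0"
    obtain q where q: "q \<in> g_polys g x0 n"
      and diff: "\<And>x y. x \<le> y \<Longrightarrow> p y - p x = (LINT s:{x..<y}|stieltjes_measure g. q s)"
      using g_polys_Suc_diff[OF g Suc.prems] by metis
    \<comment> \<open>The factor \<open>p (t (i + 1))\<close> encodes the required sign, so rises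
      and falls of \<open>p\<close> are treated together.\<close>
    have "\<exists>s\<in>{t i..<t (i + 1)}. 0 < p (t (i + 1)) * q s" if "i \<in> {1..Suc n + 1}" for i
    proof -
      have i: "t i < t (i + 1)" "p (t i) * p (t (i + 1)) < 0"
        using alt that by auto
      \<comment> \<open>Expanding gives a square minus a negative number.\<close>
      then have "0 < p (t (i + 1)) * (p (t (i + 1)) - p (t i))"
        by (simp add: right_diff_distrib mult.commute less_le_trans[OF _ zero_le_square])
      then show ?thesis
        using diff[of "t i" "t (i + 1)"] i set_integral_pos_imp_ex_pos by (metis less_imp_le)
    qed
    then obtain s where s: "\<And>i. i \<in> {1..Suc n + 1} \<Longrightarrow>
        s i \<in> {t i..<t (i + 1)} \<and> 0 < p (t (i + 1)) * q (s i)"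
      by metis
    have "s i < s (i + 1) \<and> q (s i) * q (s (i + 1)) < 0" if "i \<in> {1..n + 1}" for i
    proof -
      \<comment> \<open>The open right end of each interval makes the new points strictly
        increasing.\<close>
      have "s i < t (i + 1)" "t (i + 1) \<le> s (i + 1)"
        and pos: "0 < p (t (i + 1)) * q (s i)" "0 < p (t (i + 1 + 1)) * q (s (i + 1))"
        using s[of i] s[of "i + 1"] that by auto
      moreover have "p (t (i + 1)) * p (t (i + 1 + 1)) < 0"
        using alt that by auto
      ultimately show ?thesis
        by (auto simp: zero_less_mult_iff mult_less_0_iff)
    qed
    then show False
      using Suc.IH[OF q, of s] by blast
  qed
qed

section \<open>From extended points to real points\<close>

fun perturb :: "real \<Rightarrow> ext_pt \<Rightarrow> real" where
  "perturb e (Pt t) = t"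
| "perturb e (RPlus t) = t + e"

text \<open>This carries strict inequalities between values at extended points over to real points,
  for all small \<open>e > 0\<close>.\<close>

lemma tendsto_perturb:
  assumes "derivator g" "locally_g_lipschitz g f"
  shows "((\<lambda>e. f (perturb e x)) \<longlongrightarrow> ext_eval f x) (at_right 0)"
proof (cases x)
  case (RPlus t)
  have "(f \<longlongrightarrow> right_lim f t) (at_right t)"
    by (rule locally_g_lipschitz_right_lim[OF assms])
  then have "((\<lambda>e. f (e + t)) \<longlongrightarrow> right_lim f t) (at_right 0)"
    by (simp add: at_right_to_0[of t] filterlim_filtermap)
  then show ?thesis
    by (simp add: RPlus add.commute)
qed simp

lemma eventually_perturb_less:
  assumes g: "derivator g" and less: "g_less g x y"
  shows "\<forall>\<^sub>F e in at_right 0. perturb e x < perturb e y"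
proof -
  \<comment> \<open>\<open>g\<close> satisfies its own Lipschitz condition with constant 1, so the
    convergence applies to \<open>g\<close> too.\<close>
  have lip: "locally_g_lipschitz g g"
    unfolding locally_g_lipschitz_def
    using g by (intro allI exI[of _ 1]) (auto simp: derivator_def mono_def)
  have "((\<lambda>e. g (perturb e y) - g (perturb e x)) \<longlongrightarrow> ext_eval g y - ext_eval g x) (at_right 0)"
    by (intro tendsto_diff tendsto_perturb[OF g lip])
  then have "\<forall>\<^sub>F e in at_right 0. 0 < g (perturb e y) - g (perturb e x)"
    by (rule order_tendstoD(1)) (use less in \<open>simp add: g_less_def\<close>)
  then show ?thesis
  proof eventually_elim
    \<comment> \<open>Monotonicity of \<open>g\<close> turns the strict order of its values into
      that of the arguments.\<close>
    case (elim e)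
    then show ?case
      using g monoD[of g "perturb e y" "perturb e x"] by (force simp: derivator_def)
  qed
qed

theorem corollary4p8:
  fixes g p :: "real \<Rightarrow> real" and x0 :: real and n :: nat
  assumes "derivator g"
    and "p \<in> g_polys g x0 n"
  shows "\<not> (\<exists>t :: nat \<Rightarrow> ext_pt.
            (\<forall>i\<in>{1..n + 2}. t i \<in> ext_line g) \<and>
            (\<forall>i\<in>{1..n + 1}. g_less g (t i) (t (i + 1))) \<and>
            (\<forall>i\<in>{1..n + 1}. ext_eval p (t i) * ext_eval p (t (i + 1)) < 0))"
proof clarify
  fix t :: "nat \<Rightarrow> ext_pt"
  assume less: "\<forall>i\<in>{1..n + 1}. g_less g (t i) (t (i + 1))"
    and alt: "\<forall>i\<in>{1..n + 1}. ext_eval p (t i) * ext_eval p (t (i + 1)) < 0"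
  have "\<forall>\<^sub>F e in at_right 0. p (perturb e (t i)) * p (perturb e (t (i + 1))) < 0"
    if "i \<in> {1..n + 1}" for i
  proof (rule order_tendstoD(2))
    show "((\<lambda>e. p (perturb e (t i)) * p (perturb e (t (i + 1)))) \<longlongrightarrow>
        ext_eval p (t i) * ext_eval p (t (i + 1))) (at_right 0)"
      by (intro tendsto_mult tendsto_perturb[OF assms(1)] locally_g_lipschitz_g_polys[OF assms])
  qed (use alt that in blast)
  \<comment> \<open>There are finitely many conditions, so a single \<open>e\<close> serves all
    points at once.\<close>
  then have "\<forall>\<^sub>F e in at_right 0. \<forall>i\<in>{1..n + 1}. perturb e (t i) < perturb e (t (i + 1)) \<and>
      p (perturb e (t i)) * p (perturb e (t (i + 1))) < 0"
    using less by (intro eventually_ball_finite ballI eventually_conj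
        eventually_perturb_less[OF assms(1)]) auto
  then obtain e where "\<forall>i\<in>{1..n + 1}. perturb e (t i) < perturb e (t (i + 1)) \<and>
      p (perturb e (t i)) * p (perturb e (t (i + 1))) < 0"
    using eventually_happens'[OF trivial_limit_at_right_real] by blast
  then show False
    using g_polys_sign_changes_real[OF assms, of "\<lambda>i. perturb e (t i)"] by blast
qed

end
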